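(* Let $(\mathcal{A},\Sigma(\mathcal{A}),\mu)$ be a measure space with $\mu$ positive and $\sigma$-finite, let $\mathcal{H}=\int^\oplus_{\mathcal{A}}\mathcal{H}^\alpha\,d\mu(\alpha)$ be a direct integral Hilbert space, and let $Q$ be a closable Hermitian quadratic form on a dense subspace $\mathcal{D}\subset\mathcal{H}$. Then $Q$ is orthogonally additive if and only if it is countably orthogonally additive.
   Context: A Hermitian quadratic form $Q$ on a dense subspace $\mathcal{D}\subset\mathcal{H}$ is the diagonal $Q(\Phi):=Q(\Phi,\Phi)$ of a sesquilinear form $Q:\mathcal{D}\times\mathcal{D}\to\mathbb{C}$ (antilinear in the first entry, linear in the second) with $Q(\Phi,\Psi)=\overline{Q(\Psi,\Phi)}$. It is closable if for every sequence $\{\Phi_n\}\subset\mathcal{D}$ with $\Phi_n\to0$ in $\mathcal{H}$ and $\lim_{n,m\to\infty}Q(\Phi_n-\Phi_m)=0$ one has $\lim_nQ(\Phi_n)=0$. $\int^\oplus_{\mathcal{A}}\mathcal{H}^\alpha\,d\mu(\alpha)$ is the usual direct integral of a $\mu$-measurable field of complex separable Hilbert spaces, with $\|\Phi\|^2=\int_{\mathcal{A}}\|\Phi(\alpha)\|_\alpha^2\,d\mu(\alpha)$. For $\Delta\in\Sigma(\mathcal{A})$, $P_\Delta$ is the orthogonal projection onto $\int_\Delta^\oplus\mathcal{H}^\alpha\,d\mu(\alpha)$. $(Q,\mathcal{D})$ is orthogonally additive if: (i) $P_\Delta\mathcal{D}\subset\mathcal{D}$ for all $\Delta\in\Sigma(\mathcal{A})$;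 (ii) for each $\Phi\in\mathcal{D}$ there is $M_\Phi>0$ with $|Q(P_\Delta\Phi)|<M_\Phi$ for all $\Delta\in\Sigma(\mathcal{A})$; (iii) for each finite measurable partition $\{\Delta_i\}_{i=1}^N$ of a $\Delta\in\Sigma(\mathcal{A})$ and each $\Phi\in\mathcal{D}$, $Q(P_\Delta\Phi)=\sum_{i=1}^NQ(P_{\Delta_i}\Phi)$. $(Q,\mathcal{D})$ is countably orthogonally additive if: (i) $P_\Delta\mathcal{D}\subset\mathcal{D}$ for all $\Delta\in\Sigma(\mathcal{A})$; (ii) for each countable measurable partition $\{\Delta_i\}_{i\in\mathbb{N}}$ of a $\Delta\in\Sigma(\mathcal{A})$ and each $\Phi\in\mathcal{D}$, $Q(P_\Delta\Phi)=\sum_{i=1}^\infty Q(P_{\Delta_i}\Phi)$ (convergence of the series being part of the requirement). *)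

theory Defs
  imports "HOL-Analysis.Analysis" "HOL-Algebra.Module"
begin

section \<open>Complex Hilbert spaces with explicit carriers\<close>

text \<open>
  The fibres of a direct integral vary with the base point, so Hilbert spaces are represented by
  records rather than by a type class.  They extend the library's modules; as there, the
  fields \<^const>\<open>mult\<close> and \<^const>\<open>one\<close> inherited from rings play no role.
\<close>

definition complex_ring :: "complex ring" where
  "complex_ring = \<lparr>carrier = UNIV, mult = (*), one = 1, zero = 0, add = (+)\<rparr>"

record 'h hspace = "(complex, 'h) module" +
  cinner :: "'h \<Rightarrow> 'h \<Rightarrow> complex"

definition hnorm :: "('h, 'm) hspace_scheme \<Rightarrow> 'h \<Rightarrow> real" where
  "hnorm V x = sqrt (Re (cinner V x x))"

text \<open>\<^const>\<open>Metric_space\<close> demands nonnegativity and symmetry also off the carrier, hence the default value.\<close>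

definition hdist :: "('h, 'm) hspace_scheme \<Rightarrow> 'h \<Rightarrow> 'h \<Rightarrow> real" where
  "hdist V x y = (if x \<in> carrier V \<and> y \<in> carrier V then hnorm V (x \<ominus>\<^bsub>V\<^esub> y) else 0)"

abbreviation htopology :: "('h, 'm) hspace_scheme \<Rightarrow> 'h topology" where
  "htopology V \<equiv> Metric_space.mtopology (carrier V) (hdist V)"

abbreviation subspace_of :: "'h set \<Rightarrow> ('h, 'm) hspace_scheme \<Rightarrow> bool" where
  "subspace_of D V \<equiv> submodule D complex_ring V"

definition dense_in :: "'h set \<Rightarrow> ('h, 'm) hspace_scheme \<Rightarrow> bool" where
  "dense_in D V \<longleftrightarrow> D \<subseteq> carrier V \<and> htopology V closure_of D = carrier V"

definition cspan :: "('h, 'm) hspace_scheme \<Rightarrow> 'h set \<Rightarrow> 'h set" where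
  "cspan V B = (\<lambda>N. subspace_of N V) hull B"

locale complex_hilbert_space = Module.module complex_ring V
  for V :: "('h, 'm) hspace_scheme" (structure) +
  assumes cinner_add_right:
      "\<lbrakk>x \<in> carrier V; y \<in> carrier V; z \<in> carrier V\<rbrakk>
        \<Longrightarrow> cinner V x (y \<oplus> z) = cinner V x y + cinner V x z"
    and cinner_smult_right:
      "\<lbrakk>x \<in> carrier V; y \<in> carrier V\<rbrakk> \<Longrightarrow> cinner V x (c \<odot> y) = c * cinner V x y"
    and cinner_commute:
      "\<lbrakk>x \<in> carrier V; y \<in> carrier V\<rbrakk> \<Longrightarrow> cinner V x y = cnj (cinner V y x)"
    and cinner_nonneg: "x \<in> carrier V \<Longrightarrow> 0 \<le> Re (cinner V x x)"
    and cinner_definite: "\<lbrakk>x \<in> carrier V; cinner V x x = 0\<rbrakk> \<Longrightarrow> x = \<zero>"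
    and complete: "Metric_space.mcomplete (carrier V) (hdist V)"

locale separable_complex_hilbert_space = complex_hilbert_space +
  assumes separable: "separable_space (htopology V)"

definition orth_proj :: "('h, 'm) hspace_scheme \<Rightarrow> 'h set \<Rightarrow> 'h \<Rightarrow> 'h" where
  "orth_proj V K x = (THE y. y \<in> K \<and> (\<forall>u\<in>K. cinner V u (x \<ominus>\<^bsub>V\<^esub> y) = 0))"


section \<open>Direct integrals\<close>

text \<open>
  A measurable field of Hilbert spaces in the sense of Dixmier: besides the fibres \<open>H \<alpha>\<close>, it
  consists of the linear space \<open>S\<close> of those vector fields that are declared measurable.
  Vector fields are unconstrained outside \<open>space M\<close>.
\<close>

locale measurable_hilbert_field =
  fixes M :: "'a measure" and H :: "'a \<Rightarrow> 'h hspace" and S :: "('a \<Rightarrow> 'h) set"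
  assumes fibre: "\<alpha> \<in> space M \<Longrightarrow> separable_complex_hilbert_space (H \<alpha>)"
    and section_closed: "x \<in> S \<Longrightarrow> x \<in> (\<Pi> \<alpha>\<in>space M. carrier (H \<alpha>))"
    and section_zero: "(\<lambda>\<alpha>. \<zero>\<^bsub>H \<alpha>\<^esub>) \<in> S"
    and section_add: "\<lbrakk>x \<in> S; y \<in> S\<rbrakk> \<Longrightarrow> (\<lambda>\<alpha>. x \<alpha> \<oplus>\<^bsub>H \<alpha>\<^esub> y \<alpha>) \<in> S"
    and section_smult: "x \<in> S \<Longrightarrow> (\<lambda>\<alpha>. c \<odot>\<^bsub>H \<alpha>\<^esub> x \<alpha>) \<in> S"
    and norm_measurable: "x \<in> S \<Longrightarrow> (\<lambda>\<alpha>. hnorm (H \<alpha>) (x \<alpha>)) \<in> borel_measurable M"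
    and saturated:
      "\<lbrakk>y \<in> (\<Pi> \<alpha>\<in>space M. carrier (H \<alpha>));
        \<And>x. x \<in> S \<Longrightarrow> (\<lambda>\<alpha>. cinner (H \<alpha>) (x \<alpha>) (y \<alpha>)) \<in> borel_measurable M\<rbrakk> \<Longrightarrow> y \<in> S"
    and fundamental_sequence:
      "\<exists>e :: nat \<Rightarrow> 'a \<Rightarrow> 'h. (\<forall>n. e n \<in> S) \<and>
        (\<forall>\<alpha>\<in>space M. dense_in (cspan (H \<alpha>) (range (\<lambda>n. e n \<alpha>))) (H \<alpha>))"

definition L2_sections ::
    "'a measure \<Rightarrow> ('a \<Rightarrow> 'h hspace) \<Rightarrow> ('a \<Rightarrow> 'h) set \<Rightarrow> ('a \<Rightarrow> 'h) set" where
  "L2_sections M H S = {x \<in> S. integrable M (\<lambda>\<alpha>. (hnorm (H \<alpha>) (x \<alpha>))\<^sup>2)}"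

definition ae_rel ::
    "'a measure \<Rightarrow> ('a \<Rightarrow> 'h hspace) \<Rightarrow> ('a \<Rightarrow> 'h) set \<Rightarrow> (('a \<Rightarrow> 'h) \<times> ('a \<Rightarrow> 'h)) set" where
  "ae_rel M H S =
    {(x, y). x \<in> L2_sections M H S \<and> y \<in> L2_sections M H S \<and> (AE \<alpha> in M. x \<alpha> = y \<alpha>)}"

text \<open>The elements of the direct integral are the a.e.-equality classes of square-integrable sections.\<close>

definition direct_integral ::
    "'a measure \<Rightarrow> ('a \<Rightarrow> 'h hspace) \<Rightarrow> ('a \<Rightarrow> 'h) set \<Rightarrow> ('a \<Rightarrow> 'h) set hspace" where
  "direct_integral M H S =
    \<lparr>carrier = L2_sections M H S // ae_rel M H S,
     mult = undefined,
     one = undefined,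
     zero = ae_rel M H S `` {\<lambda>\<alpha>. \<zero>\<^bsub>H \<alpha>\<^esub>},
     add = (\<lambda>X Y. \<Union>x\<in>X. \<Union>y\<in>Y. ae_rel M H S `` {\<lambda>\<alpha>. x \<alpha> \<oplus>\<^bsub>H \<alpha>\<^esub> y \<alpha>}),
     smult = (\<lambda>c X. \<Union>x\<in>X. ae_rel M H S `` {\<lambda>\<alpha>. c \<odot>\<^bsub>H \<alpha>\<^esub> x \<alpha>}),
     cinner = (\<lambda>X Y. the_elem (\<Union>x\<in>X. \<Union>y\<in>Y. {LINT \<alpha>|M. cinner (H \<alpha>) (x \<alpha>) (y \<alpha>)}))\<rparr>"

text \<open>\<open>\<integral>\<^sub>\<Delta> H \<alpha> d\<mu>\<close> as a subspace of the direct integral over the whole base.\<close>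

definition direct_integral_on ::
    "'a measure \<Rightarrow> ('a \<Rightarrow> 'h hspace) \<Rightarrow> ('a \<Rightarrow> 'h) set \<Rightarrow> 'a set \<Rightarrow> ('a \<Rightarrow> 'h) set set" where
  "direct_integral_on M H S \<Delta> =
    {X \<in> carrier (direct_integral M H S). \<forall>x\<in>X. AE \<alpha> in M. \<alpha> \<notin> \<Delta> \<longrightarrow> x \<alpha> = \<zero>\<^bsub>H \<alpha>\<^esub>}"

definition proj_on ::
    "'a measure \<Rightarrow> ('a \<Rightarrow> 'h hspace) \<Rightarrow> ('a \<Rightarrow> 'h) set \<Rightarrow> 'a set \<Rightarrow> ('a \<Rightarrow> 'h) set \<Rightarrow> ('a \<Rightarrow> 'h) set" where
  "proj_on M H S \<Delta> = orth_proj (direct_integral M H S) (direct_integral_on M H S \<Delta>)"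


section \<open>Hermitian quadratic forms\<close>

text \<open>A form is given by its sesquilinear form; the associated quadratic form is \<open>\<Phi> \<mapsto> Q \<Phi> \<Phi>\<close>.\<close>

locale hermitian_form =
  fixes V :: "('v, 'm) hspace_scheme" (structure) and D :: "'v set" and Q :: "'v \<Rightarrow> 'v \<Rightarrow> complex"
  assumes domain_subspace: "subspace_of D V"
    and domain_dense: "dense_in D V"
    and add_left: "\<lbrakk>x \<in> D; y \<in> D; z \<in> D\<rbrakk> \<Longrightarrow> Q (x \<oplus> y) z = Q x z + Q y z"
    and add_right: "\<lbrakk>x \<in> D; y \<in> D; z \<in> D\<rbrakk> \<Longrightarrow> Q x (y \<oplus> z) = Q x y + Q x z"
    and smult_left: "\<lbrakk>x \<in> D; y \<in> D\<rbrakk> \<Longrightarrow> Q (c \<odot> x) y = cnj c * Q x y"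
    and smult_right: "\<lbrakk>x \<in> D; y \<in> D\<rbrakk> \<Longrightarrow> Q x (c \<odot> y) = c * Q x y"
    and hermitian: "\<lbrakk>x \<in> D; y \<in> D\<rbrakk> \<Longrightarrow> Q x y = cnj (Q y x)"

definition closable ::
    "('v, 'm) hspace_scheme \<Rightarrow> 'v set \<Rightarrow> ('v \<Rightarrow> 'v \<Rightarrow> complex) \<Rightarrow> bool" where
  "closable V D Q \<longleftrightarrow>
    (\<forall>\<Phi> :: nat \<Rightarrow> 'v.
      range \<Phi> \<subseteq> D \<and> (\<lambda>n. hnorm V (\<Phi> n)) \<longlonglongrightarrow> 0 \<and>
      ((\<lambda>(n, m). Q (\<Phi> n \<ominus>\<^bsub>V\<^esub> \<Phi> m) (\<Phi> n \<ominus>\<^bsub>V\<^esub> \<Phi> m)) \<longlongrightarrow> 0) (sequentially \<times>\<^sub>F sequentially)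
      \<longrightarrow> (\<lambda>n. Q (\<Phi> n) (\<Phi> n)) \<longlonglongrightarrow> 0)"

text \<open>Blocks of a partition are allowed to be empty, so that finite partitions are countable ones.\<close>

definition orthogonally_additive ::
    "'a measure \<Rightarrow> ('a \<Rightarrow> 'h hspace) \<Rightarrow> ('a \<Rightarrow> 'h) set \<Rightarrow> ('a \<Rightarrow> 'h) set set \<Rightarrow>
      (('a \<Rightarrow> 'h) set \<Rightarrow> ('a \<Rightarrow> 'h) set \<Rightarrow> complex) \<Rightarrow> bool" where
  "orthogonally_additive M H S D Q \<longleftrightarrow>
    (let P = proj_on M H S in
      (\<forall>\<Delta>\<in>sets M. P \<Delta> ` D \<subseteq> D) \<and>
      (\<forall>\<Phi>\<in>D. \<exists>B>0. \<forall>\<Delta>\<in>sets M. cmod (Q (P \<Delta> \<Phi>) (P \<Delta> \<Phi>)) < B) \<and>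
      (\<forall>\<Delta>\<in>sets M. \<forall>(N::nat) (E :: nat \<Rightarrow> 'a set).
        E ` {1..N} \<subseteq> sets M \<and> disjoint_family_on E {1..N} \<and> (\<Union>i\<in>{1..N}. E i) = \<Delta> \<longrightarrow>
        (\<forall>\<Phi>\<in>D. Q (P \<Delta> \<Phi>) (P \<Delta> \<Phi>) = (\<Sum>i=1..N. Q (P (E i) \<Phi>) (P (E i) \<Phi>)))))"

definition countably_orthogonally_additive ::
    "'a measure \<Rightarrow> ('a \<Rightarrow> 'h hspace) \<Rightarrow> ('a \<Rightarrow> 'h) set \<Rightarrow> ('a \<Rightarrow> 'h) set set \<Rightarrow>
      (('a \<Rightarrow> 'h) set \<Rightarrow> ('a \<Rightarrow> 'h) set \<Rightarrow> complex) \<Rightarrow> bool" where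
  "countably_orthogonally_additive M H S D Q \<longleftrightarrow>
    (let P = proj_on M H S in
      (\<forall>\<Delta>\<in>sets M. P \<Delta> ` D \<subseteq> D) \<and>
      (\<forall>\<Delta>\<in>sets M. \<forall>E :: nat \<Rightarrow> 'a set.
        range E \<subseteq> sets M \<and> disjoint_family E \<and> (\<Union>i. E i) = \<Delta> \<longrightarrow>
        (\<forall>\<Phi>\<in>D. (\<lambda>i. Q (P (E i) \<Phi>) (P (E i) \<Phi>)) sums Q (P \<Delta> \<Phi>) (P \<Delta> \<Phi>))))"

end

theory Submission
  imports Defs
begin

text \<open>Fix \<Phi> in \<open>D\<close> and consider the set function \<open>\<nu>\<close>
  sending a measurable set \<Delta> to the value of the quadratic form at the projection of \<Phi>
  onto \<Delta>. Both notions of additivity say that the projections preserve \<open>D\<close>;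
  beyond that they concern \<open>\<nu>\<close> alone, one asking for bounded finite additivity, the
  other for countable additivity.

  Countable additivity implies the other notion by pure measure theory. Padding with empty blocks
  gives finite additivity, and a countably additive set function on a sigma-algebra with values in a
  normed space is automatically bounded (\<open>countably_additive_bounded\<close>).

  Conversely, \<open>\<nu>\<close> is real because the form is Hermitian, and boundedness makes the
  series of \<open>\<nu>\<close> over disjoint sets converge absolutely
  (\<open>bounded_finitely_additive_summable\<close>). It remains to exclude a loss of mass in the
  limit, that is, to show that \<open>\<nu>\<close> tends to 0 along the tails \<open>F n\<close> of
  a partition. Here the Hilbert space enters: the projection onto \<Delta> is truncation of sections
  to \<Delta> (\<open>proj_on_cls\<close>). Hence the projections of \<Phi> onto \<open>F n\<close>
  tend to 0 in norm (\<open>hnorm_proj_on_tendsto_0\<close>), and their differences are projections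
  onto differences of tails (\<open>proj_on_diff\<close>), where the form takes the small values of
  Cauchy sections of the series. Closability then gives the claim.\<close>

section \<open>Additive set functions\<close>

lemma finitely_additive_UN:
  fixes \<nu> :: "'a set \<Rightarrow> 'b::comm_monoid_add"
  assumes empty: "\<nu> {} = 0"
    and Un: "\<And>A B. \<lbrakk>A \<in> sets M; B \<in> sets M; A \<inter> B = {}\<rbrakk> \<Longrightarrow> \<nu> (A \<union> B) = \<nu> A + \<nu> B"
    and "finite I" "E ` I \<subseteq> sets M" "disjoint_family_on E I"
  shows "\<nu> (\<Union>i\<in>I. E i) = (\<Sum>i\<in>I. \<nu> (E i))"
  using assms(3-5)
proof (induction I rule: finite_induct)
  case (insert i I)
  have "E i \<inter> (\<Union>j\<in>I. E j) = {}"
    using insert.prems(2) insert.hyps(2) by (fastforce simp: disjoint_family_on_def)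
  moreover have "(\<Union>j\<in>I. E j) \<in> sets M"
    using insert.hyps(1) insert.prems(1) by (intro sets.finite_UN) auto
  moreover have "\<nu> (\<Union>j\<in>I. E j) = (\<Sum>j\<in>I. \<nu> (E j))"
    using insert by (auto simp: disjoint_family_on_def)
  ultimately show ?case
    using insert Un[of "E i" "\<Union>j\<in>I. E j"] by simp
qed (simp add: empty)

text \<open>The nonnegative and the negative terms can be collected separately. Each collection is a
  finite subset of indices, so each contributes at most \<open>B\<close> in absolute value, and the
  sums of absolute values stay below \<open>2 * B\<close>.\<close>

lemma summable_if_finite_sums_bounded:
  fixes f :: "nat \<Rightarrow> real"
  assumes "\<And>I. finite I \<Longrightarrow> \<bar>sum f I\<bar> \<le> B"
  shows "summable f"
proof -
  have "(\<Sum>k\<le>n. \<bar>f k\<bar>) \<le> 2 * B" for n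
  proof -
    have "(\<Sum>k\<le>n. \<bar>f k\<bar>) =
        (\<Sum>k\<in>{..n} \<inter> {k. 0 \<le> f k}. \<bar>f k\<bar>) + (\<Sum>k\<in>{..n} \<inter> - {k. 0 \<le> f k}. \<bar>f k\<bar>)"
      using sum.Int_Diff[of "{..n}" "\<lambda>k. \<bar>f k\<bar>" "{k. 0 \<le> f k}"] by (simp add: Diff_eq)
    also have "\<dots> = sum f ({..n} \<inter> {k. 0 \<le> f k}) - sum f ({..n} \<inter> - {k. 0 \<le> f k})"
      by (simp add: sum_negf[symmetric])
    also have "\<dots> \<le> 2 * B"
      using assms[of "{..n} \<inter> {k. 0 \<le> f k}"] assms[of "{..n} \<inter> - {k. 0 \<le> f k}"] by simp
    finally show ?thesis .
  qed
  then have "summable (\<lambda>k. \<bar>f k\<bar>)"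
    by (intro bounded_imp_summable) auto
  then show ?thesis
    by (rule summable_rabs_cancel)
qed

text \<open>Every finite sum of the terms is the value of \<open>\<nu>\<close> on one measurable
  set, a union of blocks, so the bound on \<open>\<nu>\<close> bounds all finite sums at
  once.\<close>

lemma bounded_finitely_additive_summable:
  fixes \<nu> :: "'a set \<Rightarrow> real"
  assumes "\<nu> {} = 0"
    and "\<And>A B. \<lbrakk>A \<in> sets M; B \<in> sets M; A \<inter> B = {}\<rbrakk> \<Longrightarrow> \<nu> (A \<union> B) = \<nu> A + \<nu> B"
    and bound: "\<And>A. A \<in> sets M \<Longrightarrow> \<bar>\<nu> A\<bar> \<le> B"
    and E: "range E \<subseteq> sets M" "disjoint_family E"
  shows "summable (\<lambda>i::nat. \<nu> (E i))"
proof (rule summable_if_finite_sums_bounded)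
  fix I :: "nat set"
  assume I: "finite I"
  have "\<nu> (\<Union>i\<in>I. E i) = (\<Sum>i\<in>I. \<nu> (E i))"
    using E I by (intro finitely_additive_UN[where M = M] assms) (auto simp: disjoint_family_on_def)
  moreover have "(\<Union>i\<in>I. E i) \<in> sets M"
    using E I by (intro sets.finite_UN) auto
  ultimately show "\<bar>\<Sum>i\<in>I. \<nu> (E i)\<bar> \<le> B"
    using bound by metis
qed

section \<open>Consequences of countable additivity: finite additivity and boundedness\<close>

text \<open>The partition into empty sets yields a constant series, which converges only if its term
  is 0.\<close>

lemma countably_additive_empty:
  fixes \<nu> :: "'a set \<Rightarrow> 'b::real_normed_vector"
  assumes "\<And>E. \<lbrakk>range E \<subseteq> sets M; disjoint_family E\<rbrakk> \<Longrightarrow> (\<lambda>i::nat. \<nu> (E i)) sums \<nu> (\<Union>i. E i)"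
  shows "\<nu> {} = 0"
  using assms[of "\<lambda>_. {}"] by (simp add: disjoint_family_on_def sums_iff summable_const_iff)

lemma countably_additive_Un:
  fixes \<nu> :: "'a set \<Rightarrow> 'b::real_normed_vector"
  assumes add: "\<And>E. \<lbrakk>range E \<subseteq> sets M; disjoint_family E\<rbrakk> \<Longrightarrow> (\<lambda>i::nat. \<nu> (E i)) sums \<nu> (\<Union>i. E i)"
    and "A \<in> sets M" "B \<in> sets M" "A \<inter> B = {}"
  shows "\<nu> (A \<union> B) = \<nu> A + \<nu> B"
proof -
  have "disjoint_family (binaryset A B)"
    using assms(4) by (auto simp: disjoint_family_on_def binaryset_def)
  then have "(\<lambda>i. \<nu> (binaryset A B i)) sums \<nu> (A \<union> B)"
    using add[of "binaryset A B"] assms(2,3) by (simp add: range_binaryset_eq UN_binaryset_eq)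
  then show ?thesis
    using binaryset_sums[of \<nu> A B] countably_additive_empty[OF add] sums_unique2 by blast
qed

text \<open>
  If some set had subsets of arbitrarily large \<open>\<nu>\<close>, then so would one of the two pieces in any
  splitting of it.  Choosing splittings whose pieces are both large gives a decreasing sequence
  along which \<open>\<nu>\<close> diverges, although countable additivity makes it converge.
\<close>

lemma countably_additive_bounded:
  fixes \<nu> :: "'a set \<Rightarrow> 'b::real_normed_vector"
  assumes add: "\<And>E. \<lbrakk>range E \<subseteq> sets M; disjoint_family E\<rbrakk> \<Longrightarrow> (\<lambda>i::nat. \<nu> (E i)) sums \<nu> (\<Union>i. E i)"
  shows "\<exists>B>0. \<forall>A\<in>sets M. norm (\<nu> A) < B"
proof (rule ccontr)
  assume contr: "\<not> ?thesis"
  have split: "\<nu> A = \<nu> (A \<inter> F) + \<nu> (A - F)" if "A \<in> sets M" "F \<in> sets M" for A F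
    using countably_additive_Un[of M \<nu> "A \<inter> F" "A - F", OF add] that by (auto simp: Int_Diff_Un)
  \<comment> \<open>\<open>unb A\<close> is the property to be passed down a decreasing sequence:
    \<open>\<nu>\<close> takes arbitrarily large values on measurable subsets of
    \<open>A\<close>.\<close>
  define unb where "unb A \<longleftrightarrow> A \<in> sets M \<and> (\<forall>K. \<exists>F\<in>sets M. F \<subseteq> A \<and> norm (\<nu> F) > K)" for A
  have "unb (space M)"
    unfolding unb_def
  proof (intro conjI allI sets.top)
    fix K
    \<comment> \<open>The negated claim speaks only of positive bounds, and its failure gives a
      non-strict inequality; \<open>max 1 (K + 1)\<close> is positive and exceeds
      \<open>K\<close>.\<close>
    have "\<not> (\<forall>A\<in>sets M. norm (\<nu> A) < max 1 (K + 1))"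
      using contr by (metis less_max_iff_disj zero_less_one)
    then show "\<exists>F\<in>sets M. F \<subseteq> space M \<and> K < norm (\<nu> F)"
      using sets.sets_into_space by (fastforce simp: not_less)
  qed
  have step: "\<exists>B. (unb B \<and> real n \<le> norm (\<nu> B)) \<and> B \<subseteq> A" if A: "unb A" for A n
  proof -
    \<comment> \<open>The margin \<open>norm (\<nu> A)\<close> makes both pieces large:
      \<open>\<nu> F\<close> by choice, and \<open>\<nu> (A - F)\<close> because it differs from
      \<open>- \<nu> F\<close> only by \<open>\<nu> A\<close>.\<close>
    obtain F where F: "F \<in> sets M" "F \<subseteq> A" "norm (\<nu> F) > real n + norm (\<nu> A)"
      using A unfolding unb_def by blast
    have AF: "\<nu> A = \<nu> F + \<nu> (A - F)"
      using split[of A F] A F by (simp add: unb_def Int_absorb1)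
    show ?thesis
    proof (cases "unb F")
      case True
      then show ?thesis
        using F norm_ge_zero[of "\<nu> A"] by (intro exI[of _ F]) (auto simp del: norm_ge_zero)
    next
      case False
      \<comment> \<open>Since \<open>F\<close> contributes at most \<open>K\<close> to any subset of
        \<open>A\<close>, the large values must come from \<open>A - F\<close>.\<close>
      then obtain K where K: "norm (\<nu> G) \<le> K" if "G \<in> sets M" "G \<subseteq> F" for G
        using F(1) unfolding unb_def by (meson not_le)
      have "unb (A - F)"
        unfolding unb_def
      proof (intro conjI allI)
        fix L
        obtain G where G: "G \<in> sets M" "G \<subseteq> A" "norm (\<nu> G) > L + K"
          using A unfolding unb_def by blast
        have "norm (\<nu> G) \<le> norm (\<nu> (G \<inter> F)) + norm (\<nu> (G - F))"
          using split[of G F] G F by (simp add: norm_triangle_ineq)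
        moreover have "norm (\<nu> (G \<inter> F)) \<le> K"
          using G F by (intro K) auto
        ultimately show "\<exists>G\<in>sets M. G \<subseteq> A - F \<and> L < norm (\<nu> G)"
          using G F by (intro bexI[of _ "G - F"]) auto
      qed (use A F in \<open>auto simp: unb_def\<close>)
      moreover have "norm (\<nu> F) \<le> norm (\<nu> A) + norm (\<nu> (A - F))"
        using norm_triangle_ineq4[of "\<nu> A" "\<nu> (A - F)"] AF by simp
      ultimately show ?thesis
        using F by (intro exI[of _ "A - F"]) auto
    qed
  qed
  obtain A where A: "\<And>n. unb (A n) \<and> real n \<le> norm (\<nu> (A n))" "\<And>n. A (Suc n) \<subseteq> A n"
    using dependent_nat_choice[of "\<lambda>n B. unb B \<and> real n \<le> norm (\<nu> B)" "\<lambda>n A B. B \<subseteq> A"]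
      step \<open>unb (space M)\<close> by (metis of_nat_0 norm_ge_zero)
  have dec: "A n \<subseteq> A m" if "m \<le> n" for m n
    using lift_Suc_antimono_le[of A, OF A(2) that] .
  have sets: "A n \<in> sets M" for n
    using A(1) by (simp add: unb_def)
  \<comment> \<open>The rings between successive sets are disjoint, and their series telescopes, so
    its convergence forces \<open>\<nu> (A n)\<close> to converge.\<close>
  define E where "E n = A n - A (Suc n)" for n
  have "disjoint_family E"
    unfolding disjoint_family_on_def E_def
  proof (intro ballI impI)
    fix m n :: nat
    assume "m \<noteq> n"
    then show "(A m - A (Suc m)) \<inter> (A n - A (Suc n)) = {}"
      using dec[of "Suc m" n] dec[of "Suc n" m] by (cases m n rule: linorder_cases) auto
  qed
  moreover have "range E \<subseteq> sets M"
    using sets by (auto simp: E_def)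
  ultimately have "summable (\<lambda>n. \<nu> (E n))"
    using sums_summable[OF add] by blast
  moreover have "\<nu> (E n) = \<nu> (A n) - \<nu> (A (Suc n))" for n
    using split[OF sets[of n] sets[of "Suc n"]] A(2)[of n] by (simp add: E_def Int_absorb1)
  ultimately have "summable (\<lambda>n. \<nu> (A n) - \<nu> (A (Suc n)))"
    by simp
  then have "convergent (\<lambda>n. \<nu> (A 0) - \<nu> (A n))"
    using sum_lessThan_telescope'[of "\<lambda>n. \<nu> (A n)"] by (simp add: summable_iff_convergent)
  then have "convergent (\<lambda>n. \<nu> (A n))"
    using convergent_diff[OF convergent_const[of "\<nu> (A 0)"], of "\<lambda>n. \<nu> (A 0) - \<nu> (A n)"] by simp
  then obtain K where K: "norm (\<nu> (A n)) \<le> K" for n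
    using convergent_imp_Bseq[THEN BseqD] by blast
  obtain n where "K < real n"
    using reals_Archimedean2 by blast
  then show False
    using A(1)[of n] K[of n] by linarith
qed


section \<open>Hilbert space fibres\<close>

context complex_hilbert_space
begin

lemma smult_in_carrier [simp]: "x \<in> carrier V \<Longrightarrow> c \<odot> x \<in> carrier V"
  by (simp add: complex_ring_def)

text \<open>Subtraction is defined through the group inverse, whereas sections are closed under
  addition and scalar multiples; the scalar \<open>-1\<close> translates between the two.\<close>

lemma minus_eq_smult:
  assumes "x \<in> carrier V" "y \<in> carrier V"
  shows "x \<ominus> y = x \<oplus> (-1) \<odot> y"
proof -
  have "(-1) \<odot> y \<oplus> y = (-1 + 1) \<odot> y"
    using smult_l_distr[of "-1" 1 y] smult_one[OF assms(2)] assms by (simp add: complex_ring_def)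
  also have "\<dots> = \<zero>"
    using smult_l_null[OF assms(2)] by (simp add: complex_ring_def)
  finally have "\<ominus> y = (-1) \<odot> y"
    using assms by (intro M.minus_equality) auto
  then show ?thesis
    by (simp add: a_minus_def)
qed

lemma cinner_zero_right [simp]: "x \<in> carrier V \<Longrightarrow> cinner V x \<zero> = 0"
  using cinner_smult_right[of x \<zero> 0] smult_l_null[OF M.zero_closed]
  by (simp add: complex_ring_def)

lemma cinner_zero_left [simp]: "x \<in> carrier V \<Longrightarrow> cinner V \<zero> x = 0"
  using cinner_commute[of \<zero> x] by simp

lemma hnorm_nonneg [simp]: "x \<in> carrier V \<Longrightarrow> 0 \<le> hnorm V x"
  by (simp add: hnorm_def cinner_nonneg)

lemma hnorm_zero [simp]: "hnorm V \<zero> = 0"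
  by (simp add: hnorm_def)

lemma hnorm_power2: "x \<in> carrier V \<Longrightarrow> (hnorm V x)\<^sup>2 = Re (cinner V x x)"
  by (simp add: hnorm_def cinner_nonneg)

lemma cinner_self: "x \<in> carrier V \<Longrightarrow> cinner V x x = of_real ((hnorm V x)\<^sup>2)"
  using cinner_commute[of x x] by (simp add: hnorm_power2 complex_eq_iff)

lemma hnorm_eq_0: "\<lbrakk>x \<in> carrier V; hnorm V x = 0\<rbrakk> \<Longrightarrow> x = \<zero>"
  using cinner_self[of x] cinner_definite by simp

lemma hnorm_power2_add:
  assumes "x \<in> carrier V" "y \<in> carrier V"
  shows "(hnorm V (x \<oplus> y))\<^sup>2 = (hnorm V x)\<^sup>2 + (hnorm V y)\<^sup>2 + 2 * Re (cinner V x y)"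
proof -
  have "cinner V (x \<oplus> y) (x \<oplus> y) = cinner V (x \<oplus> y) x + cinner V (x \<oplus> y) y"
    using assms by (simp add: cinner_add_right)
  also have "cinner V (x \<oplus> y) x = cnj (cinner V x x + cinner V x y)"
    using assms by (subst cinner_commute) (auto simp: cinner_add_right)
  also have "cinner V (x \<oplus> y) y = cnj (cinner V y x + cinner V y y)"
    using assms by (subst cinner_commute) (auto simp: cinner_add_right)
  also have "cinner V y x = cnj (cinner V x y)"
    using assms by (intro cinner_commute)
  finally show ?thesis
    using assms by (simp add: hnorm_power2)
qed

lemma hnorm_smult:
  assumes "x \<in> carrier V"
  shows "hnorm V (c \<odot> x) = cmod c * hnorm V x"
proof -
  have "cinner V (c \<odot> x) (c \<odot> x) = c * cnj (c * cinner V x x)"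
    using assms cinner_commute[of "c \<odot> x" x] by (simp add: cinner_smult_right)
  also have "\<dots> = of_real ((cmod c * hnorm V x)\<^sup>2)"
    using complex_norm_square[of c] assms by (simp add: cinner_self power_mult_distrib)
  finally show ?thesis
    using assms by (simp add: hnorm_def[of V "c \<odot> x"] del: of_real_power of_real_mult)
qed

text \<open>The real part comes from expanding the square of the norm of the sum. Replacing
  \<open>y\<close> by \<open>\<i> \<odot> y\<close> turns the real part of the inner product into
  minus its imaginary part. The purpose is to carry measurability from norms to inner
  products.\<close>

lemma cinner_polarization:
  assumes "x \<in> carrier V" "y \<in> carrier V"
  shows "cinner V x y =
    of_real (((hnorm V (x \<oplus> y))\<^sup>2 - (hnorm V x)\<^sup>2 - (hnorm V y)\<^sup>2) / 2) +
    \<i> * of_real (((hnorm V x)\<^sup>2 + (hnorm V y)\<^sup>2 - (hnorm V (x \<oplus> \<i> \<odot> y))\<^sup>2) / 2)"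
  using hnorm_power2_add[OF assms] hnorm_power2_add[of x "\<i> \<odot> y"] assms
  by (simp add: complex_eq_iff hnorm_smult cinner_smult_right)

text \<open>This is the parallelogram law with the square of the norm of the difference
  dropped.\<close>

lemma hnorm_power2_add_le:
  assumes "x \<in> carrier V" "y \<in> carrier V"
  shows "(hnorm V (x \<oplus> y))\<^sup>2 \<le> 2 * (hnorm V x)\<^sup>2 + 2 * (hnorm V y)\<^sup>2"
  using hnorm_power2_add[OF assms] hnorm_power2_add[of x "(-1) \<odot> y"] assms
    zero_le_power2[of "hnorm V (x \<oplus> (-1) \<odot> y)"]
  by (simp add: hnorm_smult cinner_smult_right)

lemma smult_zero [simp]: "c \<odot> \<zero> = \<zero>"
  by (simp add: smult_r_null complex_ring_def)

lemma add_minus_smult [simp]: "x \<in> carrier V \<Longrightarrow> x \<oplus> (-1) \<odot> x = \<zero>"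
  using minus_eq_smult[of x x] by (simp add: a_minus_def M.r_neg)

end


section \<open>The direct integral\<close>

text \<open>Truncation is the action on representatives of the orthogonal projection
  \<open>proj_on M H S \<Delta>\<close>.\<close>

definition cut_section :: "('a \<Rightarrow> 'h hspace) \<Rightarrow> 'a set \<Rightarrow> ('a \<Rightarrow> 'h) \<Rightarrow> 'a \<Rightarrow> 'h" where
  "cut_section H \<Delta> x = (\<lambda>\<alpha>. if \<alpha> \<in> \<Delta> then x \<alpha> else \<zero>\<^bsub>H \<alpha>\<^esub>)"

context measurable_hilbert_field
begin

abbreviation L2 :: "('a \<Rightarrow> 'h) set" where "L2 \<equiv> L2_sections M H S"
abbreviation DI :: "('a \<Rightarrow> 'h) set hspace" where "DI \<equiv> direct_integral M H S"

definition cls :: "('a \<Rightarrow> 'h) \<Rightarrow> ('a \<Rightarrow> 'h) set" where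
  "cls x = ae_rel M H S `` {x}"

lemma fibre_hilbert: "\<alpha> \<in> space M \<Longrightarrow> complex_hilbert_space (H \<alpha>)"
  using fibre separable_complex_hilbert_space.axioms(1) by blast

lemma section_in_carrier: "\<lbrakk>x \<in> S; \<alpha> \<in> space M\<rbrakk> \<Longrightarrow> x \<alpha> \<in> carrier (H \<alpha>)"
  using section_closed by blast

lemma L2_in_carrier: "\<lbrakk>x \<in> L2; \<alpha> \<in> space M\<rbrakk> \<Longrightarrow> x \<alpha> \<in> carrier (H \<alpha>)"
  by (simp add: L2_sections_def section_in_carrier)

section \<open>Measurable and square-integrable sections\<close>

lemma cinner_measurable:
  assumes "x \<in> S" "y \<in> S"
  shows "(\<lambda>\<alpha>. cinner (H \<alpha>) (x \<alpha>) (y \<alpha>)) \<in> borel_measurable M"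
proof -
  have [measurable]: "(\<lambda>\<alpha>. hnorm (H \<alpha>) (x \<alpha>)) \<in> borel_measurable M"
    "(\<lambda>\<alpha>. hnorm (H \<alpha>) (y \<alpha>)) \<in> borel_measurable M"
    "(\<lambda>\<alpha>. hnorm (H \<alpha>) (x \<alpha> \<oplus>\<^bsub>H \<alpha>\<^esub> y \<alpha>)) \<in> borel_measurable M"
    "(\<lambda>\<alpha>. hnorm (H \<alpha>) (x \<alpha> \<oplus>\<^bsub>H \<alpha>\<^esub> \<i> \<odot>\<^bsub>H \<alpha>\<^esub> y \<alpha>)) \<in> borel_measurable M"
    using assms norm_measurable[OF section_add[OF assms]]
      norm_measurable[OF section_add[OF assms(1) section_smult[OF assms(2)]]]
    by (auto intro: norm_measurable)
  show ?thesis
    by (subst measurable_cong[OF complex_hilbert_space.cinner_polarization[OF fibre_hilbert]])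
      (use assms in \<open>auto simp: section_in_carrier\<close>)
qed

lemma L2_zero: "(\<lambda>\<alpha>. \<zero>\<^bsub>H \<alpha>\<^esub>) \<in> L2"
proof -
  have "integrable M (\<lambda>\<alpha>. (hnorm (H \<alpha>) \<zero>\<^bsub>H \<alpha>\<^esub>)\<^sup>2) = integrable M (\<lambda>\<alpha>. 0 :: real)"
    by (intro Bochner_Integration.integrable_cong refl) (auto simp: complex_hilbert_space.hnorm_zero[OF fibre_hilbert])
  then show ?thesis
    by (simp add: L2_sections_def section_zero)
qed

lemma L2_smult:
  assumes "x \<in> L2"
  shows "(\<lambda>\<alpha>. c \<odot>\<^bsub>H \<alpha>\<^esub> x \<alpha>) \<in> L2"
proof -
  have "integrable M (\<lambda>\<alpha>. (hnorm (H \<alpha>) (c \<odot>\<^bsub>H \<alpha>\<^esub> x \<alpha>))\<^sup>2) =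
      integrable M (\<lambda>\<alpha>. (cmod c)\<^sup>2 * (hnorm (H \<alpha>) (x \<alpha>))\<^sup>2)"
    using assms by (intro Bochner_Integration.integrable_cong refl)
      (auto simp: L2_sections_def section_in_carrier power_mult_distrib
        complex_hilbert_space.hnorm_smult[OF fibre_hilbert])
  then show ?thesis
    using assms by (simp add: L2_sections_def section_smult)
qed

lemma L2_add:
  assumes "x \<in> L2" "y \<in> L2"
  shows "(\<lambda>\<alpha>. x \<alpha> \<oplus>\<^bsub>H \<alpha>\<^esub> y \<alpha>) \<in> L2"
proof -
  have S: "x \<in> S" "y \<in> S"
    using assms by (auto simp: L2_sections_def)
  have "integrable M (\<lambda>\<alpha>. (hnorm (H \<alpha>) (x \<alpha> \<oplus>\<^bsub>H \<alpha>\<^esub> y \<alpha>))\<^sup>2)"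
  proof (rule Bochner_Integration.integrable_bound)
    show "integrable M (\<lambda>\<alpha>. 2 * (hnorm (H \<alpha>) (x \<alpha>))\<^sup>2 + 2 * (hnorm (H \<alpha>) (y \<alpha>))\<^sup>2)"
      using assms by (auto simp: L2_sections_def)
    show "(\<lambda>\<alpha>. (hnorm (H \<alpha>) (x \<alpha> \<oplus>\<^bsub>H \<alpha>\<^esub> y \<alpha>))\<^sup>2) \<in> borel_measurable M"
      using norm_measurable[OF section_add[OF S]] by measurable
    show "AE \<alpha> in M. norm ((hnorm (H \<alpha>) (x \<alpha> \<oplus>\<^bsub>H \<alpha>\<^esub> y \<alpha>))\<^sup>2) \<le>
        norm (2 * (hnorm (H \<alpha>) (x \<alpha>))\<^sup>2 + 2 * (hnorm (H \<alpha>) (y \<alpha>))\<^sup>2)"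
      using complex_hilbert_space.hnorm_power2_add_le[OF fibre_hilbert] S
      by (intro AE_I2) (simp add: section_in_carrier)
  qed
  then show ?thesis
    by (simp add: L2_sections_def section_add S)
qed

text \<open>Truncation multiplies by a non-constant scalar function, so closure under constant
  multiples does not give it. Saturation does: inner products with a truncated section are
  measurable functions cut off to \<Delta>.\<close>

lemma cut_section_in_S:
  assumes "x \<in> S" "\<Delta> \<in> sets M"
  shows "cut_section H \<Delta> x \<in> S"
proof (rule saturated)
  show "cut_section H \<Delta> x \<in> (\<Pi> \<alpha>\<in>space M. carrier (H \<alpha>))"
    using section_in_carrier[OF assms(1)] section_in_carrier[OF section_zero]
    by (auto simp: cut_section_def)
  fix y
  assume y: "y \<in> S"
  have "(\<lambda>\<alpha>. cinner (H \<alpha>) (y \<alpha>) (cut_section H \<Delta> x \<alpha>)) \<in> borel_measurable M \<longleftrightarrow>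
      (\<lambda>\<alpha>. if \<alpha> \<in> \<Delta> then cinner (H \<alpha>) (y \<alpha>) (x \<alpha>) else 0) \<in> borel_measurable M"
    using section_in_carrier[OF y]
    by (intro measurable_cong)
      (simp add: cut_section_def complex_hilbert_space.cinner_zero_right[OF fibre_hilbert])
  moreover have "(\<lambda>\<alpha>. if \<alpha> \<in> \<Delta> then cinner (H \<alpha>) (y \<alpha>) (x \<alpha>) else 0) \<in> borel_measurable M"
    using assms(2) cinner_measurable[OF y assms(1)] by measurable
  ultimately show "(\<lambda>\<alpha>. cinner (H \<alpha>) (y \<alpha>) (cut_section H \<Delta> x \<alpha>)) \<in> borel_measurable M"
    by simp
qed

lemma hnorm_cut_section:
  "\<alpha> \<in> space M \<Longrightarrow>
    hnorm (H \<alpha>) (cut_section H \<Delta> x \<alpha>) = (if \<alpha> \<in> \<Delta> then hnorm (H \<alpha>) (x \<alpha>) else 0)"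
  by (simp add: cut_section_def complex_hilbert_space.hnorm_zero[OF fibre_hilbert])

lemma L2_cut_section:
  assumes "x \<in> L2" "\<Delta> \<in> sets M"
  shows "cut_section H \<Delta> x \<in> L2"
proof -
  have S: "x \<in> S"
    using assms by (simp add: L2_sections_def)
  have "integrable M (\<lambda>\<alpha>. (hnorm (H \<alpha>) (cut_section H \<Delta> x \<alpha>))\<^sup>2)"
  proof (rule Bochner_Integration.integrable_bound)
    show "integrable M (\<lambda>\<alpha>. (hnorm (H \<alpha>) (x \<alpha>))\<^sup>2)"
      using assms by (auto simp: L2_sections_def)
    show "(\<lambda>\<alpha>. (hnorm (H \<alpha>) (cut_section H \<Delta> x \<alpha>))\<^sup>2) \<in> borel_measurable M"
      using norm_measurable[OF cut_section_in_S[OF S assms(2)]] by measurable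
    show "AE \<alpha> in M. norm ((hnorm (H \<alpha>) (cut_section H \<Delta> x \<alpha>))\<^sup>2) \<le> norm ((hnorm (H \<alpha>) (x \<alpha>))\<^sup>2)"
      by (intro AE_I2) (simp add: hnorm_cut_section)
  qed
  then show ?thesis
    by (simp add: L2_sections_def cut_section_in_S[OF S assms(2)])
qed

section \<open>Classes of sections and the operations on them\<close>

lemma equiv_ae_rel: "equiv L2 (ae_rel M H S)"
proof (rule equivI)
  show "trans (ae_rel M H S)"
  proof (rule transI)
    fix x y z
    assume "(x, y) \<in> ae_rel M H S" "(y, z) \<in> ae_rel M H S"
    moreover from this have "AE \<alpha> in M. x \<alpha> = z \<alpha>"
      by (auto simp: ae_rel_def elim: AE_mp)
    ultimately show "(x, z) \<in> ae_rel M H S"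
      by (simp add: ae_rel_def)
  qed
qed (auto simp: ae_rel_def refl_on_def sym_def eq_commute)

lemma cls_eq_iff: "\<lbrakk>x \<in> L2; y \<in> L2\<rbrakk> \<Longrightarrow> cls x = cls y \<longleftrightarrow> (AE \<alpha> in M. x \<alpha> = y \<alpha>)"
  using eq_equiv_class_iff[OF equiv_ae_rel] by (auto simp: cls_def ae_rel_def)

lemma cls_cong: "\<lbrakk>x \<in> L2; y \<in> L2; \<And>\<alpha>. \<alpha> \<in> space M \<Longrightarrow> x \<alpha> = y \<alpha>\<rbrakk> \<Longrightarrow> cls x = cls y"
  by (simp add: cls_eq_iff)

lemma in_cls_iff: "x \<in> L2 \<Longrightarrow> y \<in> cls x \<longleftrightarrow> y \<in> L2 \<and> (AE \<alpha> in M. x \<alpha> = y \<alpha>)"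
  by (auto simp: cls_def ae_rel_def)

lemma cls_in_carrier [simp]: "x \<in> L2 \<Longrightarrow> cls x \<in> carrier DI"
  by (simp add: direct_integral_def cls_def quotientI)

lemma carrierE:
  assumes "X \<in> carrier DI"
  obtains x where "x \<in> L2" "X = cls x"
  using assms by (auto simp: direct_integral_def cls_def elim: quotientE)

lemma zero_cls: "\<zero>\<^bsub>DI\<^esub> = cls (\<lambda>\<alpha>. \<zero>\<^bsub>H \<alpha>\<^esub>)"
  by (simp add: direct_integral_def cls_def)

text \<open>The union over all representatives in the definition of the sum collapses, because a.e.
  equal representatives give the same class. The same argument serves \<open>smult_cls\<close> and,
  with singletons of integrals, \<open>cinner_cls\<close>.\<close>

lemma add_cls:
  assumes "x \<in> L2" "y \<in> L2"
  shows "cls x \<oplus>\<^bsub>DI\<^esub> cls y = cls (\<lambda>\<alpha>. x \<alpha> \<oplus>\<^bsub>H \<alpha>\<^esub> y \<alpha>)"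
proof -
  have "cls (\<lambda>\<alpha>. x' \<alpha> \<oplus>\<^bsub>H \<alpha>\<^esub> y' \<alpha>) = cls (\<lambda>\<alpha>. x \<alpha> \<oplus>\<^bsub>H \<alpha>\<^esub> y \<alpha>)"
    if "x' \<in> cls x" "y' \<in> cls y" for x' y'
  proof -
    have *: "x' \<in> L2" "y' \<in> L2" "AE \<alpha> in M. x \<alpha> = x' \<alpha>" "AE \<alpha> in M. y \<alpha> = y' \<alpha>"
      using that assms by (auto simp: in_cls_iff)
    from *(3,4) have "AE \<alpha> in M. x' \<alpha> \<oplus>\<^bsub>H \<alpha>\<^esub> y' \<alpha> = x \<alpha> \<oplus>\<^bsub>H \<alpha>\<^esub> y \<alpha>"
      by eventually_elim simp
    then show ?thesis
      using * assms by (subst cls_eq_iff) (auto simp: L2_add)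
  qed
  moreover have "x \<in> cls x" "y \<in> cls y"
    using assms by (auto simp: in_cls_iff)
  ultimately have "(\<Union>x'\<in>cls x. \<Union>y'\<in>cls y. cls (\<lambda>\<alpha>. x' \<alpha> \<oplus>\<^bsub>H \<alpha>\<^esub> y' \<alpha>)) =
      (\<Union>x'\<in>cls x. \<Union>y'\<in>cls y. cls (\<lambda>\<alpha>. x \<alpha> \<oplus>\<^bsub>H \<alpha>\<^esub> y \<alpha>))"
    by (intro SUP_cong refl)
  also have "\<dots> = cls (\<lambda>\<alpha>. x \<alpha> \<oplus>\<^bsub>H \<alpha>\<^esub> y \<alpha>)"
    using \<open>x \<in> cls x\<close> \<open>y \<in> cls y\<close> by blast
  finally show ?thesis
    by (simp add: direct_integral_def cls_def)
qed

lemma smult_cls: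
  assumes "x \<in> L2"
  shows "c \<odot>\<^bsub>DI\<^esub> cls x = cls (\<lambda>\<alpha>. c \<odot>\<^bsub>H \<alpha>\<^esub> x \<alpha>)"
proof -
  have "cls (\<lambda>\<alpha>. c \<odot>\<^bsub>H \<alpha>\<^esub> x' \<alpha>) = cls (\<lambda>\<alpha>. c \<odot>\<^bsub>H \<alpha>\<^esub> x \<alpha>)" if "x' \<in> cls x" for x'
  proof -
    have *: "x' \<in> L2" "AE \<alpha> in M. x \<alpha> = x' \<alpha>"
      using that assms by (auto simp: in_cls_iff)
    from *(2) have "AE \<alpha> in M. c \<odot>\<^bsub>H \<alpha>\<^esub> x' \<alpha> = c \<odot>\<^bsub>H \<alpha>\<^esub> x \<alpha>"
      by eventually_elim simp
    then show ?thesis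
      using * assms by (subst cls_eq_iff) (auto simp: L2_smult)
  qed
  moreover have "x \<in> cls x"
    using assms by (auto simp: in_cls_iff)
  ultimately have "(\<Union>x'\<in>cls x. cls (\<lambda>\<alpha>. c \<odot>\<^bsub>H \<alpha>\<^esub> x' \<alpha>)) =
      (\<Union>x'\<in>cls x. cls (\<lambda>\<alpha>. c \<odot>\<^bsub>H \<alpha>\<^esub> x \<alpha>))"
    by (intro SUP_cong refl)
  also have "\<dots> = cls (\<lambda>\<alpha>. c \<odot>\<^bsub>H \<alpha>\<^esub> x \<alpha>)"
    using \<open>x \<in> cls x\<close> by blast
  finally show ?thesis
    by (simp add: direct_integral_def cls_def)
qed

lemma cinner_cls:
  assumes "x \<in> L2" "y \<in> L2"
  shows "cinner DI (cls x) (cls y) = (LINT \<alpha>|M. cinner (H \<alpha>) (x \<alpha>) (y \<alpha>))"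
proof -
  have "(LINT \<alpha>|M. cinner (H \<alpha>) (x' \<alpha>) (y' \<alpha>)) = (LINT \<alpha>|M. cinner (H \<alpha>) (x \<alpha>) (y \<alpha>))"
    if "x' \<in> cls x" "y' \<in> cls y" for x' y'
  proof (rule integral_cong_AE)
    have *: "x' \<in> L2" "y' \<in> L2" "AE \<alpha> in M. x \<alpha> = x' \<alpha>" "AE \<alpha> in M. y \<alpha> = y' \<alpha>"
      using that assms by (auto simp: in_cls_iff)
    from *(3,4) show "AE \<alpha> in M. cinner (H \<alpha>) (x' \<alpha>) (y' \<alpha>) = cinner (H \<alpha>) (x \<alpha>) (y \<alpha>)"
      by eventually_elim simp
    show "(\<lambda>\<alpha>. cinner (H \<alpha>) (x' \<alpha>) (y' \<alpha>)) \<in> borel_measurable M"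
      "(\<lambda>\<alpha>. cinner (H \<alpha>) (x \<alpha>) (y \<alpha>)) \<in> borel_measurable M"
      using * assms by (auto simp: L2_sections_def intro: cinner_measurable)
  qed
  moreover have "x \<in> cls x" "y \<in> cls y"
    using assms by (auto simp: in_cls_iff)
  ultimately have "(\<Union>x'\<in>cls x. \<Union>y'\<in>cls y. {LINT \<alpha>|M. cinner (H \<alpha>) (x' \<alpha>) (y' \<alpha>)}) =
      (\<Union>x'\<in>cls x. \<Union>y'\<in>cls y. {LINT \<alpha>|M. cinner (H \<alpha>) (x \<alpha>) (y \<alpha>)})"
    by (intro SUP_cong refl arg_cong[where f = "\<lambda>z. {z}"])
  also have "\<dots> = {LINT \<alpha>|M. cinner (H \<alpha>) (x \<alpha>) (y \<alpha>)}"
    using \<open>x \<in> cls x\<close> \<open>y \<in> cls y\<close> by blast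
  finally show ?thesis
    by (simp add: direct_integral_def)
qed

lemma hnorm_cls:
  assumes "x \<in> L2"
  shows "hnorm DI (cls x) = sqrt (LINT \<alpha>|M. (hnorm (H \<alpha>) (x \<alpha>))\<^sup>2)"
proof -
  have "(LINT \<alpha>|M. cinner (H \<alpha>) (x \<alpha>) (x \<alpha>)) = (LINT \<alpha>|M. complex_of_real ((hnorm (H \<alpha>) (x \<alpha>))\<^sup>2))"
    using assms by (intro Bochner_Integration.integral_cong refl
        complex_hilbert_space.cinner_self[OF fibre_hilbert])
      (auto simp: L2_in_carrier)
  then show ?thesis
    using assms unfolding hnorm_def[of DI] cinner_cls[OF assms assms]
    by (simp del: of_real_power)
qed

section \<open>The additive group of the direct integral\<close>

lemma fibre_abelian_monoid: "\<alpha> \<in> space M \<Longrightarrow> abelian_monoid (H \<alpha>)"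
  by (rule abelian_group.axioms(1)[OF Module.module.axioms(2)
        [OF complex_hilbert_space.axioms(1)[OF fibre_hilbert]]])

lemma add_minus_smult_cls:
  assumes "x \<in> L2"
  shows "cls x \<oplus>\<^bsub>DI\<^esub> (-1) \<odot>\<^bsub>DI\<^esub> cls x = \<zero>\<^bsub>DI\<^esub>"
proof -
  have "cls (\<lambda>\<alpha>. x \<alpha> \<oplus>\<^bsub>H \<alpha>\<^esub> (-1) \<odot>\<^bsub>H \<alpha>\<^esub> x \<alpha>) = cls (\<lambda>\<alpha>. \<zero>\<^bsub>H \<alpha>\<^esub>)"
    by (intro cls_cong complex_hilbert_space.add_minus_smult[OF fibre_hilbert]
        L2_add L2_smult L2_zero L2_in_carrier assms)
  then show ?thesis
    by (simp only: assms add_cls smult_cls L2_smult zero_cls)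
qed

lemma add_commute_DI:
  assumes "X \<in> carrier DI" "Y \<in> carrier DI"
  shows "X \<oplus>\<^bsub>DI\<^esub> Y = Y \<oplus>\<^bsub>DI\<^esub> X"
proof -
  obtain x where x: "x \<in> L2" "X = cls x"
    using assms(1) by (rule carrierE)
  obtain y where y: "y \<in> L2" "Y = cls y"
    using assms(2) by (rule carrierE)
  have "cls (\<lambda>\<alpha>. x \<alpha> \<oplus>\<^bsub>H \<alpha>\<^esub> y \<alpha>) = cls (\<lambda>\<alpha>. y \<alpha> \<oplus>\<^bsub>H \<alpha>\<^esub> x \<alpha>)"
    by (intro cls_cong L2_add abelian_monoid.a_comm[OF fibre_abelian_monoid] L2_in_carrier x y)
  then show ?thesis
    by (simp only: x y add_cls)
qed

text \<open>The group laws hold fibrewise and pass to classes. They make negation and subtraction in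
  \<open>DI\<close> computable, and subtraction occurs both in the characterization of projections
  and in closability.\<close>

lemma abelian_group_DI: "abelian_group DI"
proof (rule abelian_groupI)
  fix X Y Z
  assume XYZ: "X \<in> carrier DI" "Y \<in> carrier DI" "Z \<in> carrier DI"
  obtain x where x: "x \<in> L2" "X = cls x"
    using XYZ(1) by (rule carrierE)
  obtain y where y: "y \<in> L2" "Y = cls y"
    using XYZ(2) by (rule carrierE)
  obtain z where z: "z \<in> L2" "Z = cls z"
    using XYZ(3) by (rule carrierE)
  have "cls (\<lambda>\<alpha>. x \<alpha> \<oplus>\<^bsub>H \<alpha>\<^esub> y \<alpha> \<oplus>\<^bsub>H \<alpha>\<^esub> z \<alpha>) = cls (\<lambda>\<alpha>. x \<alpha> \<oplus>\<^bsub>H \<alpha>\<^esub> (y \<alpha> \<oplus>\<^bsub>H \<alpha>\<^esub> z \<alpha>))"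
    by (intro cls_cong L2_add abelian_monoid.a_assoc[OF fibre_abelian_monoid] L2_in_carrier x y z)
  then show "X \<oplus>\<^bsub>DI\<^esub> Y \<oplus>\<^bsub>DI\<^esub> Z = X \<oplus>\<^bsub>DI\<^esub> (Y \<oplus>\<^bsub>DI\<^esub> Z)"
    by (simp only: x y z add_cls L2_add)
next
  fix X
  assume X: "X \<in> carrier DI"
  then obtain x where x: "x \<in> L2" "X = cls x"
    by (rule carrierE)
  have "cls (\<lambda>\<alpha>. \<zero>\<^bsub>H \<alpha>\<^esub> \<oplus>\<^bsub>H \<alpha>\<^esub> x \<alpha>) = cls x"
    by (intro cls_cong L2_add L2_zero abelian_monoid.l_zero[OF fibre_abelian_monoid] L2_in_carrier x)
  then show "\<zero>\<^bsub>DI\<^esub> \<oplus>\<^bsub>DI\<^esub> X = X"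
    by (simp only: x zero_cls add_cls L2_zero)
  have m: "(-1) \<odot>\<^bsub>DI\<^esub> X \<in> carrier DI"
    using x by (simp add: smult_cls L2_smult)
  then show "\<exists>Y\<in>carrier DI. Y \<oplus>\<^bsub>DI\<^esub> X = \<zero>\<^bsub>DI\<^esub>"
    using add_commute_DI[OF X m] add_minus_smult_cls[OF x(1)] x(2) by (intro bexI[OF _ m]) simp
next
  fix X Y
  assume "X \<in> carrier DI" "Y \<in> carrier DI"
  then show "X \<oplus>\<^bsub>DI\<^esub> Y \<in> carrier DI"
    by (elim carrierE) (simp add: add_cls L2_add)
qed (simp add: zero_cls L2_zero, rule add_commute_DI)

lemma minus_DI:
  assumes "X \<in> carrier DI" "Y \<in> carrier DI"
  shows "X \<ominus>\<^bsub>DI\<^esub> Y = X \<oplus>\<^bsub>DI\<^esub> (-1) \<odot>\<^bsub>DI\<^esub> Y"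
proof -
  interpret DI: abelian_group DI
    by (rule abelian_group_DI)
  obtain y where y: "y \<in> L2" "Y = cls y"
    using assms carrierE by blast
  then have m: "(-1) \<odot>\<^bsub>DI\<^esub> Y \<in> carrier DI"
    by (simp add: smult_cls L2_smult)
  moreover have "(-1) \<odot>\<^bsub>DI\<^esub> Y \<oplus>\<^bsub>DI\<^esub> Y = \<zero>\<^bsub>DI\<^esub>"
    using y add_minus_smult_cls m assms by (simp add: DI.a_comm)
  ultimately have "\<ominus>\<^bsub>DI\<^esub> Y = (-1) \<odot>\<^bsub>DI\<^esub> Y"
    using assms by (intro DI.minus_equality)
  then show ?thesis
    by (simp add: a_minus_def)
qed

lemma minus_cls:
  assumes "x \<in> L2" "y \<in> L2"
  shows "cls x \<ominus>\<^bsub>DI\<^esub> cls y = cls (\<lambda>\<alpha>. x \<alpha> \<oplus>\<^bsub>H \<alpha>\<^esub> (-1) \<odot>\<^bsub>H \<alpha>\<^esub> y \<alpha>)"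
  using assms by (simp add: minus_DI smult_cls add_cls L2_smult)

section \<open>Projections as truncations\<close>

lemma cut_section_diff:
  assumes "x \<in> S" "\<alpha> \<in> space M" "F \<subseteq> G"
  shows "cut_section H G x \<alpha> \<oplus>\<^bsub>H \<alpha>\<^esub> (-1) \<odot>\<^bsub>H \<alpha>\<^esub> cut_section H F x \<alpha> = cut_section H (G - F) x \<alpha>"
proof -
  interpret h: complex_hilbert_space "H \<alpha>"
    by (rule fibre_hilbert[OF assms(2)])
  show ?thesis
    using section_in_carrier[OF assms(1,2)] assms(3) by (auto simp: cut_section_def)
qed

text \<open>Vanishing a.e. off \<Delta> is invariant under a.e. equality, so a single representative
  decides it.\<close>

lemma direct_integral_on_cls_iff:
  assumes "x \<in> L2"
  shows "cls x \<in> direct_integral_on M H S \<Delta> \<longleftrightarrow> (AE \<alpha> in M. \<alpha> \<notin> \<Delta> \<longrightarrow> x \<alpha> = \<zero>\<^bsub>H \<alpha>\<^esub>)"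
proof -
  have "AE \<alpha> in M. \<alpha> \<notin> \<Delta> \<longrightarrow> y \<alpha> = \<zero>\<^bsub>H \<alpha>\<^esub>"
    if "AE \<alpha> in M. \<alpha> \<notin> \<Delta> \<longrightarrow> x \<alpha> = \<zero>\<^bsub>H \<alpha>\<^esub>" "AE \<alpha> in M. x \<alpha> = y \<alpha>" for y
    using that by eventually_elim simp
  moreover have "x \<in> cls x"
    using assms by (simp add: in_cls_iff)
  ultimately show ?thesis
    using assms unfolding direct_integral_on_def
    by (auto simp: in_cls_iff)
qed

text \<open>
  For uniqueness, a competitor \<open>y\<close> is tested against \<open>cut_section H \<Delta> x - y\<close>, which lies in the
  range; there \<open>x - y\<close> may be replaced by \<open>cut_section H \<Delta> x - y\<close>, whose norm hence vanishes.
\<close>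

lemma proj_on_cls:
  assumes x: "x \<in> L2" and \<Delta>: "\<Delta> \<in> sets M"
  shows "proj_on M H S \<Delta> (cls x) = cls (cut_section H \<Delta> x)"
  unfolding proj_on_def orth_proj_def
proof (rule the_equality, intro conjI ballI)
  note cut = L2_cut_section[OF x \<Delta>]
  show "cls (cut_section H \<Delta> x) \<in> direct_integral_on M H S \<Delta>"
    using cut by (simp add: direct_integral_on_cls_iff) (simp add: cut_section_def)
  fix U
  assume U: "U \<in> direct_integral_on M H S \<Delta>"
  then obtain u where u: "u \<in> L2" "U = cls u"
    by (auto simp: direct_integral_on_def elim: carrierE)
  then have u0: "AE \<alpha> in M. \<alpha> \<notin> \<Delta> \<longrightarrow> u \<alpha> = \<zero>\<^bsub>H \<alpha>\<^esub>"
    using U by (simp add: direct_integral_on_cls_iff)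
  have d: "(\<lambda>\<alpha>. x \<alpha> \<oplus>\<^bsub>H \<alpha>\<^esub> (-1) \<odot>\<^bsub>H \<alpha>\<^esub> cut_section H \<Delta> x \<alpha>) \<in> L2"
    using x cut by (intro L2_add L2_smult)
  \<comment> \<open>On \<Delta> the second argument is zero; off \<Delta> the first one is, almost
    everywhere.\<close>
  have "AE \<alpha> in M. cinner (H \<alpha>) (u \<alpha>) (x \<alpha> \<oplus>\<^bsub>H \<alpha>\<^esub> (-1) \<odot>\<^bsub>H \<alpha>\<^esub> cut_section H \<Delta> x \<alpha>) = 0"
    using u0 AE_space
  proof eventually_elim
    case (elim \<alpha>)
    interpret h: complex_hilbert_space "H \<alpha>"
      by (rule fibre_hilbert[OF elim(2)])
    have "x \<alpha> \<in> carrier (H \<alpha>)" "u \<alpha> \<in> carrier (H \<alpha>)"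
      using x u elim by (auto simp: L2_in_carrier)
    then show ?case
      using elim by (cases "\<alpha> \<in> \<Delta>") (auto simp: cut_section_def)
  qed
  then have "(LINT \<alpha>|M. cinner (H \<alpha>) (u \<alpha>) (x \<alpha> \<oplus>\<^bsub>H \<alpha>\<^esub> (-1) \<odot>\<^bsub>H \<alpha>\<^esub> cut_section H \<Delta> x \<alpha>)) = 0"
    by (rule integral_eq_zero_AE)
  then show "cinner DI U (cls x \<ominus>\<^bsub>DI\<^esub> cls (cut_section H \<Delta> x)) = 0"
    using u d x cut by (simp add: minus_cls cinner_cls)
next
  note cut = L2_cut_section[OF x \<Delta>]
  fix Y
  assume Y: "Y \<in> direct_integral_on M H S \<Delta> \<and>
    (\<forall>U\<in>direct_integral_on M H S \<Delta>. cinner DI U (cls x \<ominus>\<^bsub>DI\<^esub> Y) = 0)"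
  then obtain y where y: "y \<in> L2" "Y = cls y"
    by (auto simp: direct_integral_on_def elim: carrierE)
  then have y0: "AE \<alpha> in M. \<alpha> \<notin> \<Delta> \<longrightarrow> y \<alpha> = \<zero>\<^bsub>H \<alpha>\<^esub>"
    using Y by (simp add: direct_integral_on_cls_iff)
  define u where "u = (\<lambda>\<alpha>. cut_section H \<Delta> x \<alpha> \<oplus>\<^bsub>H \<alpha>\<^esub> (-1) \<odot>\<^bsub>H \<alpha>\<^esub> y \<alpha>)"
  define v where "v = (\<lambda>\<alpha>. x \<alpha> \<oplus>\<^bsub>H \<alpha>\<^esub> (-1) \<odot>\<^bsub>H \<alpha>\<^esub> y \<alpha>)"
  have u: "u \<in> L2" and v: "v \<in> L2"
    using x y cut unfolding u_def v_def by (auto intro!: L2_add L2_smult)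
  \<comment> \<open>For the middle identity: \<open>v\<close> agrees with \<open>u\<close> on
    \<Delta>, and both sides vanish off \<Delta>, where \<open>u\<close> is zero. Integrated, it
    turns orthogonality of \<open>u\<close> and \<open>v\<close> into vanishing of the norm of
    \<open>u\<close>.\<close>
  have "AE \<alpha> in M. (\<alpha> \<notin> \<Delta> \<longrightarrow> u \<alpha> = \<zero>\<^bsub>H \<alpha>\<^esub>) \<and>
      cinner (H \<alpha>) (u \<alpha>) (v \<alpha>) = complex_of_real ((hnorm (H \<alpha>) (u \<alpha>))\<^sup>2) \<and>
      (hnorm (H \<alpha>) (u \<alpha>) = 0 \<longrightarrow> y \<alpha> = cut_section H \<Delta> x \<alpha>)"
    using y0 AE_space
  proof eventually_elim
    case (elim \<alpha>)
    interpret h: complex_hilbert_space "H \<alpha>"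
      by (rule fibre_hilbert[OF elim(2)])
    have c: "x \<alpha> \<in> carrier (H \<alpha>)" "y \<alpha> \<in> carrier (H \<alpha>)" "u \<alpha> \<in> carrier (H \<alpha>)" "v \<alpha> \<in> carrier (H \<alpha>)"
      "cut_section H \<Delta> x \<alpha> \<in> carrier (H \<alpha>)"
      using x y u v cut elim by (auto simp: L2_in_carrier)
    have "u \<alpha> = cut_section H \<Delta> x \<alpha> \<ominus>\<^bsub>H \<alpha>\<^esub> y \<alpha>"
      using c by (simp add: u_def h.minus_eq_smult)
    \<comment> \<open>A vanishing difference makes the truncated value the inverse of the inverse of
      \<open>y \<alpha>\<close>, hence \<open>y \<alpha>\<close> itself.\<close>
    then have "hnorm (H \<alpha>) (u \<alpha>) = 0 \<longrightarrow> y \<alpha> = cut_section H \<Delta> x \<alpha>"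
      using c h.hnorm_eq_0[of "u \<alpha>"]
        h.M.minus_equality[of "cut_section H \<Delta> x \<alpha>" "\<ominus>\<^bsub>H \<alpha>\<^esub> y \<alpha>"]
      by (auto simp: a_minus_def)
    moreover have "\<alpha> \<notin> \<Delta> \<longrightarrow> u \<alpha> = \<zero>\<^bsub>H \<alpha>\<^esub>"
      using elim by (simp add: u_def cut_section_def)
    moreover have "\<alpha> \<in> \<Delta> \<longrightarrow> v \<alpha> = u \<alpha>"
      by (simp add: u_def v_def cut_section_def)
    ultimately show ?case
      using c h.cinner_self[of "u \<alpha>"] by (cases "\<alpha> \<in> \<Delta>") auto
  qed
  then have ae: "AE \<alpha> in M. \<alpha> \<notin> \<Delta> \<longrightarrow> u \<alpha> = \<zero>\<^bsub>H \<alpha>\<^esub>"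
    "AE \<alpha> in M. cinner (H \<alpha>) (u \<alpha>) (v \<alpha>) = complex_of_real ((hnorm (H \<alpha>) (u \<alpha>))\<^sup>2)"
    "AE \<alpha> in M. hnorm (H \<alpha>) (u \<alpha>) = 0 \<longrightarrow> y \<alpha> = cut_section H \<Delta> x \<alpha>"
    unfolding AE_conj_iff by blast+
  have "cls u \<in> direct_integral_on M H S \<Delta>"
    using u ae(1) by (simp add: direct_integral_on_cls_iff)
  then have "(LINT \<alpha>|M. cinner (H \<alpha>) (u \<alpha>) (v \<alpha>)) = 0"
    using Y x y u v minus_cls[OF x y(1)] by (auto simp: cinner_cls v_def)
  moreover have "(LINT \<alpha>|M. cinner (H \<alpha>) (u \<alpha>) (v \<alpha>)) =
      (LINT \<alpha>|M. complex_of_real ((hnorm (H \<alpha>) (u \<alpha>))\<^sup>2))"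
  proof (rule integral_cong_AE[OF _ _ ae(2)])
    have S: "u \<in> S" "v \<in> S"
      using u v by (auto simp: L2_sections_def)
    show "(\<lambda>\<alpha>. cinner (H \<alpha>) (u \<alpha>) (v \<alpha>)) \<in> borel_measurable M"
      using S by (rule cinner_measurable)
    show "(\<lambda>\<alpha>. complex_of_real ((hnorm (H \<alpha>) (u \<alpha>))\<^sup>2)) \<in> borel_measurable M"
      using norm_measurable[OF S(1)] by measurable
  qed
  ultimately have "(LINT \<alpha>|M. (hnorm (H \<alpha>) (u \<alpha>))\<^sup>2) = 0"
    by (simp del: of_real_power)
  then have "AE \<alpha> in M. (hnorm (H \<alpha>) (u \<alpha>))\<^sup>2 = 0"
    using u by (subst (asm) integral_nonneg_eq_0_iff_AE) (auto simp: L2_sections_def)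
  then have "AE \<alpha> in M. y \<alpha> = cut_section H \<Delta> x \<alpha>"
    using ae(3) by eventually_elim simp
  then show "Y = cls (cut_section H \<Delta> x)"
    using y cut by (simp add: cls_eq_iff)
qed

text \<open>This turns the form at a difference of projections, as closability requires it, into the
  value of the additive set function on one set.\<close>

lemma proj_on_diff:
  assumes "\<Phi> \<in> carrier DI" "F \<in> sets M" "G \<in> sets M" "F \<subseteq> G"
  shows "proj_on M H S G \<Phi> \<ominus>\<^bsub>DI\<^esub> proj_on M H S F \<Phi> = proj_on M H S (G - F) \<Phi>"
proof -
  obtain x where x: "x \<in> L2" "\<Phi> = cls x"
    using assms(1) carrierE by blast
  then have "x \<in> S"
    by (simp add: L2_sections_def)
  have "cls (\<lambda>\<alpha>. cut_section H G x \<alpha> \<oplus>\<^bsub>H \<alpha>\<^esub> (-1) \<odot>\<^bsub>H \<alpha>\<^esub> cut_section H F x \<alpha>) =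
      cls (cut_section H (G - F) x)"
    using x assms cut_section_diff[OF \<open>x \<in> S\<close>]
    by (intro cls_cong) (auto intro!: L2_add L2_smult L2_cut_section)
  then show ?thesis
    using x assms by (simp add: proj_on_cls minus_cls L2_cut_section)
qed

text \<open>Each point of the base eventually leaves the decreasing sets, so the truncated squared
  norms tend to 0 pointwise; the squared norm of the full section, which is integrable, dominates
  them.\<close>

lemma hnorm_proj_on_tendsto_0:
  fixes F :: "nat \<Rightarrow> 'a set"
  assumes "\<Phi> \<in> carrier DI" "range F \<subseteq> sets M" "decseq F" "(\<Inter>n. F n) = {}"
  shows "(\<lambda>n. hnorm DI (proj_on M H S (F n) \<Phi>)) \<longlonglongrightarrow> 0"
proof -
  obtain x where x: "x \<in> L2" "\<Phi> = cls x"
    using assms(1) carrierE by blast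
  then have "x \<in> S"
    by (simp add: L2_sections_def)
  have F: "F n \<in> sets M" for n
    using assms(2) by auto
  have "(\<lambda>n. LINT \<alpha>|M. (hnorm (H \<alpha>) (cut_section H (F n) x \<alpha>))\<^sup>2) \<longlonglongrightarrow> (LINT \<alpha>|M. 0)"
  proof (rule integral_dominated_convergence[where w = "\<lambda>\<alpha>. (hnorm (H \<alpha>) (x \<alpha>))\<^sup>2"])
    show "AE \<alpha> in M. (\<lambda>n. (hnorm (H \<alpha>) (cut_section H (F n) x \<alpha>))\<^sup>2) \<longlonglongrightarrow> 0"
    proof (rule AE_I2)
      fix \<alpha>
      assume \<alpha>: "\<alpha> \<in> space M"
      obtain k where "\<alpha> \<notin> F k"
        using assms(4) by blast
      then have "\<alpha> \<notin> F n" if "k \<le> n" for n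
        using decseqD[OF assms(3) that] by blast
      then have "\<forall>\<^sub>F n in sequentially. (hnorm (H \<alpha>) (cut_section H (F n) x \<alpha>))\<^sup>2 = 0"
        using \<alpha> by (auto simp: eventually_sequentially hnorm_cut_section)
      then show "(\<lambda>n. (hnorm (H \<alpha>) (cut_section H (F n) x \<alpha>))\<^sup>2) \<longlonglongrightarrow> 0"
        by (rule tendsto_eventually)
    qed
    show "(\<lambda>\<alpha>. (hnorm (H \<alpha>) (cut_section H (F n) x \<alpha>))\<^sup>2) \<in> borel_measurable M" for n
      using norm_measurable[OF cut_section_in_S[OF \<open>x \<in> S\<close> F[of n]]] by measurable
    show "AE \<alpha> in M. norm ((hnorm (H \<alpha>) (cut_section H (F n) x \<alpha>))\<^sup>2) \<le> (hnorm (H \<alpha>) (x \<alpha>))\<^sup>2" for n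
      by (intro AE_I2) (simp add: hnorm_cut_section)
  qed (use x in \<open>auto simp: L2_sections_def\<close>)
  then have "(\<lambda>n. sqrt (LINT \<alpha>|M. (hnorm (H \<alpha>) (cut_section H (F n) x \<alpha>))\<^sup>2)) \<longlonglongrightarrow> sqrt 0"
    by (intro tendsto_real_sqrt) simp
  then show ?thesis
    using x F by (simp add: proj_on_cls hnorm_cls L2_cut_section)
qed

end


section \<open>Orthogonal additivity\<close>

lemma (in hermitian_form) Q_real: "x \<in> D \<Longrightarrow> Q x x = of_real (Re (Q x x))"
  using hermitian[of x x] by (simp add: complex_eq_iff)

text \<open>For fixed \<Phi> the form at the projections is a countably additive complex set
  function. The bound is its automatic boundedness, and finite partitions are handled through its
  additivity on pairs.\<close>

lemma orthogonally_additive_if_countably: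
  assumes "countably_orthogonally_additive M H S D Q"
  shows "orthogonally_additive M H S D Q"
proof -
  define P where "P = proj_on M H S"
  have closed: "\<forall>\<Delta>\<in>sets M. P \<Delta> ` D \<subseteq> D"
    and add: "\<lbrakk>range E \<subseteq> sets M; disjoint_family E; \<Phi> \<in> D\<rbrakk> \<Longrightarrow>
      (\<lambda>i::nat. Q (P (E i) \<Phi>) (P (E i) \<Phi>)) sums Q (P (\<Union>i. E i) \<Phi>) (P (\<Union>i. E i) \<Phi>)" for E \<Phi>
    using assms by (auto simp: countably_orthogonally_additive_def P_def Let_def image_subset_iff)
  show ?thesis
    unfolding orthogonally_additive_def Let_def P_def[symmetric]
  proof (intro conjI closed ballI allI impI)
    fix \<Phi>
    assume "\<Phi> \<in> D"
    then show "\<exists>B>0. \<forall>\<Delta>\<in>sets M. cmod (Q (P \<Delta> \<Phi>) (P \<Delta> \<Phi>)) < B"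
      by (intro countably_additive_bounded add)
  next
    fix \<Delta> \<Phi> and N :: nat and E :: "nat \<Rightarrow> 'a set"
    assume E: "E ` {1..N} \<subseteq> sets M \<and> disjoint_family_on E {1..N} \<and> (\<Union>i\<in>{1..N}. E i) = \<Delta>"
      and \<Phi>: "\<Phi> \<in> D"
    have "Q (P (\<Union>i\<in>{1..N}. E i) \<Phi>) (P (\<Union>i\<in>{1..N}. E i) \<Phi>) =
        (\<Sum>i=1..N. Q (P (E i) \<Phi>) (P (E i) \<Phi>))"
    proof (rule finitely_additive_UN[where M = M and \<nu> = "\<lambda>A. Q (P A \<Phi>) (P A \<Phi>)"])
      show "Q (P {} \<Phi>) (P {} \<Phi>) = 0"
        by (rule countably_additive_empty[where M = M]) (use add \<Phi> in blast)
      show "Q (P (A \<union> B) \<Phi>) (P (A \<union> B) \<Phi>) = Q (P A \<Phi>) (P A \<Phi>) + Q (P B \<Phi>) (P B \<Phi>)"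
        if "A \<in> sets M" "B \<in> sets M" "A \<inter> B = {}" for A B
        by (rule countably_additive_Un[where M = M and \<nu> = "\<lambda>A. Q (P A \<Phi>) (P A \<Phi>)", OF _ that])
          (use add \<Phi> in blast)
    qed (use E in auto)
    then show "Q (P \<Delta> \<Phi>) (P \<Delta> \<Phi>) = (\<Sum>i=1..N. Q (P (E i) \<Phi>) (P (E i) \<Phi>))"
      using E by simp
  qed
qed

text \<open>
  Along the tails \<open>F n\<close> of a countable partition the vectors \<open>P (F n) \<Phi>\<close> tend to \<open>0\<close> and are
  Cauchy for \<open>Q\<close>, because \<open>Q\<close> of a difference is a section of an absolutely convergent series.
  Closability then makes the remainders of the series vanish.
\<close>

lemma countably_orthogonally_additive_if_closable:
  assumes "measurable_hilbert_field M H S"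
    and "hermitian_form (direct_integral M H S) D Q"
    and closable: "closable (direct_integral M H S) D Q"
    and "orthogonally_additive M H S D Q"
  shows "countably_orthogonally_additive M H S D Q"
proof -
  interpret measurable_hilbert_field M H S
    by fact
  interpret hermitian_form DI D Q
    by fact
  interpret DI: abelian_group DI
    by (rule abelian_group_DI)
  interpret D: submodule D complex_ring DI
    by (rule domain_subspace)
  have carrier: "\<Phi> \<in> carrier DI" if "\<Phi> \<in> D" for \<Phi>
    using D.subset that by auto
  define P where "P = proj_on M H S"
  have closed: "\<forall>\<Delta>\<in>sets M. P \<Delta> ` D \<subseteq> D"
    and bounded: "\<And>\<Phi>. \<Phi> \<in> D \<Longrightarrow> \<exists>B>0. \<forall>\<Delta>\<in>sets M. cmod (Q (P \<Delta> \<Phi>) (P \<Delta> \<Phi>)) < B"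
    and finite_add: "\<And>\<Delta> N E \<Phi>. \<lbrakk>\<Delta> \<in> sets M; E ` {1..N::nat} \<subseteq> sets M; disjoint_family_on E {1..N};
        (\<Union>i\<in>{1..N}. E i) = \<Delta>; \<Phi> \<in> D\<rbrakk> \<Longrightarrow>
        Q (P \<Delta> \<Phi>) (P \<Delta> \<Phi>) = (\<Sum>i=1..N. Q (P (E i) \<Phi>) (P (E i) \<Phi>))"
    using assms(4) unfolding orthogonally_additive_def P_def Let_def by blast+
  have PD: "P \<Delta> \<Phi> \<in> D" if "\<Delta> \<in> sets M" "\<Phi> \<in> D" for \<Delta> \<Phi>
    using closed that by blast
  have "(\<lambda>i. Q (P (E i) \<Phi>) (P (E i) \<Phi>)) sums Q (P (\<Union>i. E i) \<Phi>) (P (\<Union>i. E i) \<Phi>)"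
    if E: "range E \<subseteq> sets M" "disjoint_family E" and \<Phi>: "\<Phi> \<in> D" for E :: "nat \<Rightarrow> 'a set" and \<Phi>
  proof -
    \<comment> \<open>Taking the real part loses nothing on measurable sets, since the form is
      Hermitian, and permits the sign argument behind summability.\<close>
    define \<nu> where "\<nu> A = Re (Q (P A \<Phi>) (P A \<Phi>))" for A
    have Q_\<nu>: "Q (P A \<Phi>) (P A \<Phi>) = of_real (\<nu> A)" if "A \<in> sets M" for A
      using Q_real[OF PD[OF that \<Phi>]] by (simp add: \<nu>_def)
    have empty: "\<nu> {} = 0"
      \<comment> \<open>With \<open>N = 0\<close> the empty set is partitioned into no blocks, and
        the sum is empty.\<close>
      using finite_add[of "{}" "\<lambda>_. {}" 0 \<Phi>] \<Phi> by (simp add: \<nu>_def disjoint_family_on_def)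
    have Un: "\<nu> (A \<union> B) = \<nu> A + \<nu> B" if "A \<in> sets M" "B \<in> sets M" "A \<inter> B = {}" for A B
    proof -
      have "{1..2::nat} = {1, 2}"
        by auto
      moreover have "disjoint_family_on (\<lambda>i::nat. if i = 1 then A else B) {1, 2}"
        using that by (auto simp: disjoint_family_on_def)
      ultimately show ?thesis
        using finite_add[of "A \<union> B" "\<lambda>i. if i = 1 then A else B" 2 \<Phi>] that \<Phi>
        by (simp add: \<nu>_def Un_commute)
    qed
    obtain B where B: "\<And>A. A \<in> sets M \<Longrightarrow> cmod (Q (P A \<Phi>) (P A \<Phi>)) < B"
      using bounded[OF \<Phi>] by blast
    have "\<bar>\<nu> A\<bar> \<le> B" if "A \<in> sets M" for A
      using B[OF that] Q_\<nu>[OF that] by simp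
    then have summable: "summable (\<lambda>i. \<nu> (E i))"
      using bounded_finitely_additive_summable[OF empty Un _ E] by blast
    have Ei: "E i \<in> sets M" for i
      using E by auto
    \<comment> \<open>The tail starts at block \<open>n\<close> itself, so \<open>F 0\<close> is the
      whole union and \<open>F 0 - F n\<close> consists of exactly the first \<open>n\<close>
      blocks.\<close>
    define F where "F n = (\<Union>i\<in>{n..}. E i)" for n
    have F: "F n \<in> sets M" for n
      unfolding F_def using Ei by (intro sets.countable_UN') auto
    \<comment> \<open>No order between \<open>n\<close> and \<open>m\<close> is assumed: for
      \<open>m \<le> n\<close> both sides are empty.\<close>
    have F_diff: "F n - F m = (\<Union>i\<in>{n..<m}. E i)" for n m
    proof -
      have "\<alpha> \<notin> E j" if "\<alpha> \<in> E i" "i < m" "m \<le> j" for \<alpha> i j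
        using that disjoint_family_onD[OF E(2), of i j] by auto
      then show ?thesis
        by (force simp: F_def not_less)
    qed
    have \<nu>_diff: "\<nu> (F n - F m) = (\<Sum>i\<in>{n..<m}. \<nu> (E i))" for n m
      unfolding F_diff using E Ei
      by (intro finitely_additive_UN[where M = M] empty Un) (auto simp: disjoint_family_on_def)
    have "decseq F"
      by (force simp: decseq_def F_def)
    have "(\<Inter>n. F n) = {}"
    proof -
      have False if "\<alpha> \<in> (\<Inter>n. F n)" for \<alpha>
      proof -
        have "\<alpha> \<in> F n" for n
          using that by blast
        from this[of 0] obtain i where i: "\<alpha> \<in> E i"
          by (auto simp: F_def)
        from \<open>\<alpha> \<in> F (Suc i)\<close> obtain j where "Suc i \<le> j" "\<alpha> \<in> E j"
          by (auto simp: F_def)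
        then show False
          using i disjoint_family_onD[OF E(2), of i j] by auto
      qed
      then show ?thesis
        by blast
    qed
    have Q_diff: "Q (P (F n) \<Phi> \<ominus>\<^bsub>DI\<^esub> P (F m) \<Phi>) (P (F n) \<Phi> \<ominus>\<^bsub>DI\<^esub> P (F m) \<Phi>) =
        of_real (\<Sum>i\<in>{n..<m}. \<nu> (E i))" if "n \<le> m" for n m
      using proj_on_diff[OF carrier[OF \<Phi>] F F decseqD[OF \<open>decseq F\<close> that]]
        Q_\<nu>[of "F n - F m"] \<nu>_diff[of n m] F
      by (simp add: P_def)
    \<comment> \<open>Convergence along the product filter involves pairs in either order, while
      \<open>Q_diff\<close> covers only \<open>n \<le> m\<close>. The sign cancels because it enters
      once conjugated and once not.\<close>
    have Q_minus: "Q (X \<ominus>\<^bsub>DI\<^esub> Y) (X \<ominus>\<^bsub>DI\<^esub> Y) = Q (Y \<ominus>\<^bsub>DI\<^esub> X) (Y \<ominus>\<^bsub>DI\<^esub> X)"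
      if "X \<in> D" "Y \<in> D" for X Y
    proof -
      have neg: "\<ominus>\<^bsub>DI\<^esub> Z = (-1) \<odot>\<^bsub>DI\<^esub> Z" if "Z \<in> D" for Z
        \<comment> \<open>Negation is read off as subtraction from zero.\<close>
        using minus_DI[of "\<zero>\<^bsub>DI\<^esub>" Z] carrier[OF that] carrier[OF D.smult_closed[of "-1" Z]] that
        by (simp add: a_minus_def complex_ring_def)
      have m: "Y \<ominus>\<^bsub>DI\<^esub> X \<in> D"
        using that D.m_closed[of Y "(-1) \<odot>\<^bsub>DI\<^esub> X"] D.smult_closed[of "-1" X]
        by (simp add: a_minus_def neg complex_ring_def)
      have "X \<ominus>\<^bsub>DI\<^esub> Y = (-1) \<odot>\<^bsub>DI\<^esub> (Y \<ominus>\<^bsub>DI\<^esub> X)"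
        using neg[OF m] carrier that by (simp add: a_minus_def DI.minus_add DI.a_comm)
      then show ?thesis
        using m D.smult_closed[of "-1" "Y \<ominus>\<^bsub>DI\<^esub> X"]
        by (simp add: smult_left smult_right complex_ring_def)
    qed
    have "((\<lambda>(n, m). Q (P (F n) \<Phi> \<ominus>\<^bsub>DI\<^esub> P (F m) \<Phi>) (P (F n) \<Phi> \<ominus>\<^bsub>DI\<^esub> P (F m) \<Phi>)) \<longlongrightarrow> 0)
        (sequentially \<times>\<^sub>F sequentially)"
    proof (rule tendstoI)
      fix e :: real
      assume "0 < e"
      then obtain N where N: "\<And>m n. N \<le> m \<Longrightarrow> \<bar>\<Sum>i\<in>{m..<n}. \<nu> (E i)\<bar> < e"
        using summable_Cauchy[THEN iffD1, OF summable, rule_format, of e] by auto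
      have "dist (Q (P (F n) \<Phi> \<ominus>\<^bsub>DI\<^esub> P (F m) \<Phi>) (P (F n) \<Phi> \<ominus>\<^bsub>DI\<^esub> P (F m) \<Phi>)) 0 < e"
        if "N \<le> n" "N \<le> m" for n m
      proof (cases "n \<le> m")
        case True
        then show ?thesis
          using N[OF \<open>N \<le> n\<close>] by (simp add: Q_diff del: of_real_sum)
      next
        case False
        then show ?thesis
          using N[OF \<open>N \<le> m\<close>] Q_minus[OF PD[OF F \<Phi>] PD[OF F \<Phi>], of n m]
          by (simp add: Q_diff del: of_real_sum)
      qed
      then show "\<forall>\<^sub>F nm in sequentially \<times>\<^sub>F sequentially. dist (case nm of (n, m) \<Rightarrow>
          Q (P (F n) \<Phi> \<ominus>\<^bsub>DI\<^esub> P (F m) \<Phi>) (P (F n) \<Phi> \<ominus>\<^bsub>DI\<^esub> P (F m) \<Phi>)) 0 < e"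
        using eventually_prodI[OF eventually_ge_at_top[of N] eventually_ge_at_top[of N]]
        by (auto elim!: eventually_mono)
    qed
    moreover have "(\<lambda>n. hnorm DI (P (F n) \<Phi>)) \<longlonglongrightarrow> 0"
      unfolding P_def using F
      by (intro hnorm_proj_on_tendsto_0 carrier \<Phi> \<open>decseq F\<close> \<open>(\<Inter>n. F n) = {}\<close>) auto
    ultimately have "(\<lambda>n. Q (P (F n) \<Phi>) (P (F n) \<Phi>)) \<longlonglongrightarrow> 0"
      using closable[unfolded closable_def, rule_format, of "\<lambda>n. P (F n) \<Phi>"] PD[OF F \<Phi>] by auto
    then have "(\<lambda>n. \<nu> (F n)) \<longlonglongrightarrow> 0"
      using Q_\<nu>[OF F] tendsto_of_real_iff[of "\<lambda>n. \<nu> (F n)" 0, where ?'a = complex] by simp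
    \<comment> \<open>By finite additivity these differences are the partial sums of the series, so
      vanishing tails identify its sum as \<open>\<nu> (F 0)\<close>.\<close>
    then have "(\<lambda>n. \<nu> (F 0) - \<nu> (F n)) \<longlonglongrightarrow> \<nu> (F 0)"
      by (auto intro: tendsto_eq_intros)
    moreover have "\<nu> (F 0) - \<nu> (F n) = (\<Sum>i<n. \<nu> (E i))" for n
    proof -
      have "F n \<subseteq> F 0"
        using \<open>decseq F\<close> by (simp add: decseqD)
      then have "F n \<union> (F 0 - F n) = F 0"
        by blast
      then show ?thesis
        using Un[of "F n" "F 0 - F n"] F \<nu>_diff[of 0 n] by (simp add: atLeast0LessThan)
    qed
    ultimately have "(\<lambda>i. \<nu> (E i)) sums \<nu> (F 0)"
      by (simp add: sums_def)
    then have "(\<lambda>i. complex_of_real (\<nu> (E i))) sums of_real (\<nu> (F 0))"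
      by (simp only: sums_of_real_iff)
    moreover have "F 0 = (\<Union>i. E i)"
      by (auto simp: F_def)
    ultimately show ?thesis
      using Q_\<nu>[OF F, of 0] Q_\<nu>[OF Ei] by simp
  qed
  then show ?thesis
    using closed unfolding countably_orthogonally_additive_def P_def Let_def by blast
qed

theorem theorem3p11:
  fixes M :: "'a measure"
    and H :: "'a \<Rightarrow> 'h hspace"
    and S :: "('a \<Rightarrow> 'h) set"
    and D :: "('a \<Rightarrow> 'h) set set"
    and Q :: "('a \<Rightarrow> 'h) set \<Rightarrow> ('a \<Rightarrow> 'h) set \<Rightarrow> complex"
  assumes "sigma_finite_measure M"
    and "measurable_hilbert_field M H S"
    and "hermitian_form (direct_integral M H S) D Q"
    and "closable (direct_integral M H S) D Q"
  shows "orthogonally_additive M H S D Q \<longleftrightarrow> countably_orthogonally_additive M H S D Q"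
  using assms countably_orthogonally_additive_if_closable orthogonally_additive_if_countably
  by blast

end
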